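(* Let $\tau \subseteq \{0,1,-,+,\cdot,1',\smile,;\}$ be a relation algebra reduct signature with $\{-,;\} \subseteq \tau$. Then the class of representable $\tau$-structures does not have the finite representation property.
   Context: For binary relations $R,S \subseteq X\times X$, relational composition is $R;S=\{(x,z)\mid \exists y: (x,y)\in R,(y,z)\in S\}$, converse is $\breve R=\{(y,x)\mid (x,y)\in R\}$, and identity is $1'=\{(x,x)\mid x\in X\}$. For a signature $\tau \subseteq \{0,1,-,+,\cdot,1',\smile,;\}$, a proper $\tau$-structure is a set of binary relations over some base set $X$, closed under the operations of $\tau$, where $0,1,-,+,\cdot$ are interpreted as the empty relation, $X\times X$, complement relative to $X\times X$, union and intersection, and $1',\smile,;$ as relational identity, converse and composition. A $\tau$-structure is representable if it is isomorphic to a proper $\tau$-structure; such an isomorphism is a representation, and it is finite if the base $X$ is finite. The class of representable $\tau$-structures has the finite representation property (FRP) if every finite representable $\tau$-structure has a finite representation. *)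

theory Defs
  imports Main "HOL-Library.Infinite_Typeclass"
begin

datatype ra_symbol = Zero | One | Compl | Join | Meet | Ident | Conv | Comp

fun arity :: "ra_symbol \<Rightarrow> nat" where
  "arity Zero = 0"
| "arity One = 0"
| "arity Compl = 1"
| "arity Join = 2"
| "arity Meet = 2"
| "arity Ident = 0"
| "arity Conv = 1"
| "arity Comp = 2"

text \<open>
  Only the values \<open>interp M f xs\<close> with \<open>f\<close> in the signature under consideration and \<open>xs\<close> a list of
  \<open>arity f\<close> elements of \<open>universe M\<close> are relevant: every definition below ignores the other values.
\<close>

record 'a ra_structure =
  universe :: "'a set"
  interp :: "ra_symbol \<Rightarrow> 'a list \<Rightarrow> 'a"

definition is_structure :: "ra_symbol set \<Rightarrow> 'a ra_structure \<Rightarrow> bool" where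
  "is_structure \<tau> M \<longleftrightarrow>
     (\<forall>f\<in>\<tau>. \<forall>xs. set xs \<subseteq> universe M \<and> length xs = arity f \<longrightarrow> interp M f xs \<in> universe M)"

definition isomorphism ::
    "ra_symbol set \<Rightarrow> 'a ra_structure \<Rightarrow> 'c ra_structure \<Rightarrow> ('a \<Rightarrow> 'c) \<Rightarrow> bool" where
  "isomorphism \<tau> M N h \<longleftrightarrow>
     is_structure \<tau> M \<and> is_structure \<tau> N \<and> bij_betw h (universe M) (universe N) \<and>
     (\<forall>f\<in>\<tau>. \<forall>xs. set xs \<subseteq> universe M \<and> length xs = arity f \<longrightarrow>
        h (interp M f xs) = interp N f (map h xs))"

fun rel_interp :: "'b set \<Rightarrow> ra_symbol \<Rightarrow> 'b rel list \<Rightarrow> 'b rel" where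
  "rel_interp X Zero [] = {}"
| "rel_interp X One [] = X \<times> X"
| "rel_interp X Compl [R] = X \<times> X - R"
| "rel_interp X Join [R, S] = R \<union> S"
| "rel_interp X Meet [R, S] = R \<inter> S"
| "rel_interp X Ident [] = Id_on X"
| "rel_interp X Conv [R] = R\<inverse>"
| "rel_interp X Comp [R, S] = R O S"

definition rel_structure :: "'b set \<Rightarrow> 'b rel set \<Rightarrow> 'b rel ra_structure" where
  "rel_structure X A = \<lparr>universe = A, interp = rel_interp X\<rparr>"

definition proper_structure :: "ra_symbol set \<Rightarrow> 'b set \<Rightarrow> 'b rel set \<Rightarrow> bool" where
  "proper_structure \<tau> X A \<longleftrightarrow> A \<subseteq> Pow (X \<times> X) \<and> is_structure \<tau> (rel_structure X A)"

definition representation ::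
    "ra_symbol set \<Rightarrow> 'a ra_structure \<Rightarrow> 'b set \<Rightarrow> ('a \<Rightarrow> 'b rel) \<Rightarrow> bool" where
  "representation \<tau> M X h \<longleftrightarrow>
     (\<exists>A. proper_structure \<tau> X A \<and> isomorphism \<tau> M (rel_structure X A) h)"

text \<open>
  HOL cannot quantify over types inside a formula, so the type \<open>'b\<close> from which the bases are drawn
  and the type \<open>'a\<close> of the elements of the structures are explicit parameters. If both types are
  infinite this is no restriction: every finite structure and every finite base has a copy in them,
  and a finite structure with a representation has one over a countable base
  (downward Loewenheim-Skolem).
\<close>

definition representable :: "'b itself \<Rightarrow> ra_symbol set \<Rightarrow> 'a ra_structure \<Rightarrow> bool" where
  "representable _ \<tau> M \<longleftrightarrow> (\<exists>(X :: 'b set) h. representation \<tau> M X h)"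

definition finitely_representable :: "'b itself \<Rightarrow> ra_symbol set \<Rightarrow> 'a ra_structure \<Rightarrow> bool" where
  "finitely_representable _ \<tau> M \<longleftrightarrow> (\<exists>(X :: 'b set) h. finite X \<and> representation \<tau> M X h)"

definition has_FRP :: "'a itself \<Rightarrow> 'b itself \<Rightarrow> ra_symbol set \<Rightarrow> bool" where
  "has_FRP _ B \<tau> \<longleftrightarrow>
     (\<forall>M :: 'a ra_structure.
        finite (universe M) \<and> representable B \<tau> M \<longrightarrow> finitely_representable B \<tau> M)"

end

theory Submission
  imports Defs "HOL-Library.Countable"
begin

text \<open>
  The point algebra, i.e. the eight unions of \<open><\<close>, \<open>=\<close>, \<open>>\<close> on the rationals, is a counterexample
  for every signature. Let \<open>P\<close> and \<open>G\<close> represent \<open>\<le>\<close> and \<open>>\<close>. They are complementary and, as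
  \<open>\<le>;\<le> = \<le>\<close> and \<open>>;> = >\<close>, both transitive; hence \<open>x \<prec> y \<longleftrightarrow> (x, y) \<in> P \<and> (y, x) \<in> G\<close> is a
  strict order. The zero of the algebra can only be represented by the empty relation, so
  \<open>\<le>;> = 1\<close> yields for each \<open>x\<close> some \<open>y\<close> with \<open>x \<prec> y\<close>, which is impossible on a finite base.
\<close>

subsection \<open>Copies and embeddings of structures of relations\<close>

text \<open>\<open>has_FRP\<close> fixes the type of elements, so a structure whose elements are
  relations has to be transported there along a bijection onto a set of equal cardinality.\<close>

lemma finite_proper_structure_copy:
  fixes A :: "'b rel set"
  assumes A: "proper_structure \<tau> X A" and fin: "finite A"
  obtains M :: "'a::infinite ra_structure" and k
  where "bij_betw k A (universe M)" and "isomorphism \<tau> (rel_structure X A) M k"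
proof -
  obtain B :: "'a set" where B: "finite B" "card B = card A"
    using infinite_arbitrarily_large[OF infinite_UNIV] by blast
  then obtain k where k: "bij_betw k A B"
    using fin finite_same_card_bij by metis
  define M where
    "M = \<lparr>universe = B, interp = (\<lambda>f xs. k (rel_interp X f (map (inv_into A k) xs)))\<rparr>"
  have closed: "rel_interp X f xs \<in> A" if "f \<in> \<tau>" "set xs \<subseteq> A" "length xs = arity f" for f xs
    using A that by (simp add: proper_structure_def is_structure_def rel_structure_def)
  have img: "k ` A = B" and inj: "inj_on k A"
    using k by (auto simp: bij_betw_def)
  have "is_structure \<tau> M"
    unfolding is_structure_def
  proof (intro ballI allI impI)
    fix f xs assume f: "f \<in> \<tau>" and xs: "set xs \<subseteq> universe M \<and> length xs = arity f"
    then have "set (map (inv_into A k) xs) \<subseteq> A"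
      using img by (auto simp: M_def intro: inv_into_into)
    then have "rel_interp X f (map (inv_into A k) xs) \<in> A"
      using f xs by (intro closed) auto
    then show "interp M f xs \<in> universe M"
      using img by (auto simp: M_def)
  qed
  moreover have "k (rel_interp X f xs) = interp M f (map k xs)" if "set xs \<subseteq> A" for f xs
  proof -
    have "map (inv_into A k) (map k xs) = xs"
      using that inj by (auto intro!: map_idI)
    then show ?thesis by (simp add: M_def)
  qed
  ultimately have "isomorphism \<tau> (rel_structure X A) M k"
    using A k by (auto simp: isomorphism_def proper_structure_def rel_structure_def M_def)
  with k show thesis
    by (intro that[of k M]) (auto simp: M_def)
qed

lemma isomorphism_inv_into:
  assumes "isomorphism \<tau> M N h"
  shows "isomorphism \<tau> N M (inv_into (universe M) h)"
proof -
  let ?g = "inv_into (universe M) h"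
  have M: "is_structure \<tau> M" and N: "is_structure \<tau> N" and bij: "bij_betw h (universe M) (universe N)"
    and hom: "\<And>f xs. f \<in> \<tau> \<Longrightarrow> set xs \<subseteq> universe M \<Longrightarrow> length xs = arity f \<Longrightarrow>
      h (interp M f xs) = interp N f (map h xs)"
    using assms by (auto simp: isomorphism_def)
  have "?g (interp N f ys) = interp M f (map ?g ys)"
    if f: "f \<in> \<tau>" and ys: "set ys \<subseteq> universe N" "length ys = arity f" for f ys
  proof -
    have g: "set (map ?g ys) \<subseteq> universe M"
      using ys bij_betw_inv_into[OF bij] by (auto simp: bij_betw_def)
    have "map h (map ?g ys) = ys"
      using ys bij by (auto simp: bij_betw_def f_inv_into_f intro!: map_idI)
    then have "h (interp M f (map ?g ys)) = interp N f ys"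
      using hom[OF f g] ys by simp
    moreover have "interp M f (map ?g ys) \<in> universe M"
      using M f g ys by (simp add: is_structure_def)
    ultimately show ?thesis
      using bij by (metis bij_betw_inv_into_left)
  qed
  then show ?thesis
    using M N bij_betw_inv_into[OF bij] by (auto simp: isomorphism_def)
qed

lemma isomorphism_comp:
  assumes "isomorphism \<tau> M N h" and "isomorphism \<tau> N K g"
  shows "isomorphism \<tau> M K (g \<circ> h)"
proof -
  have "set (map h xs) \<subseteq> universe N" if "set xs \<subseteq> universe M" for xs
    using assms(1) that by (auto simp: isomorphism_def bij_betw_def)
  then show ?thesis
    using assms by (auto simp: isomorphism_def intro: bij_betw_trans)
qed

text \<open>With only \<open>Compl\<close> and \<open>Comp\<close> assumed in the signature, nothing
  says outright that \<phi> sends the empty or the full relation to its namesake.\<close>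

lemma proper_structure_homomorphism:
  assumes "{Compl, Comp} \<subseteq> \<tau>" and "proper_structure \<tau> Y B"
    and "isomorphism \<tau> (rel_structure X A) (rel_structure Y B) \<phi>"
  shows "inj_on \<phi> A"
    and "R \<in> A \<Longrightarrow> \<phi> R \<subseteq> Y \<times> Y"
    and "R \<in> A \<Longrightarrow> \<phi> (X \<times> X - R) = Y \<times> Y - \<phi> R"
    and "R \<in> A \<Longrightarrow> S \<in> A \<Longrightarrow> \<phi> (R O S) = \<phi> R O \<phi> S"
proof -
  have hom: "\<phi> (rel_interp X f xs) = rel_interp Y f (map \<phi> xs)"
    if "f \<in> \<tau>" "set xs \<subseteq> A" "length xs = arity f" for f xs
    using assms(3) that by (auto simp: isomorphism_def rel_structure_def)
  show "inj_on \<phi> A" and "R \<in> A \<Longrightarrow> \<phi> R \<subseteq> Y \<times> Y"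
    using assms(2,3)
    by (auto simp: isomorphism_def rel_structure_def proper_structure_def bij_betw_def)
  show "R \<in> A \<Longrightarrow> \<phi> (X \<times> X - R) = Y \<times> Y - \<phi> R"
    using hom[of Compl "[R]"] assms(1) by simp
  show "R \<in> A \<Longrightarrow> S \<in> A \<Longrightarrow> \<phi> (R O S) = \<phi> R O \<phi> S"
    using hom[of Comp "[R, S]"] assms(1) by (simp add: numeral_2_eq_2)
qed

subsection \<open>The obstruction to finite bases\<close>

lemma infinite_if_complementary_transitive:
  assumes "trans P" and "trans G" and "P \<inter> G = {}"
    and "Id_on Y \<subseteq> P O G" and "P \<subseteq> Y \<times> Y" and "Y \<noteq> {}"
  shows "infinite Y"
proof
  assume "finite Y"
  let ?r = "P \<inter> G\<inverse>"
  have "?r \<subseteq> Y \<times> Y" using assms(5) by blast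
  with \<open>finite Y\<close> have "finite ?r" by (meson finite_SigmaI finite_subset)
  have "trans ?r"
    using assms(1,2) by (simp add: trans_Int)
  then have "acyclic ?r"
    using assms(3) by (auto simp: acyclic_def)
  \<comment> \<open>A minimal element for the converse is a point without
    \<open>?r\<close>-successor, whereas the pair (x, x) of \<open>P O G\<close> supplies
    one.\<close>
  with \<open>finite ?r\<close> have "wf (?r\<inverse>)"
    by (simp add: finite_acyclic_wf_converse)
  then obtain x where "x \<in> Y" and "\<And>y. (y, x) \<in> ?r\<inverse> \<Longrightarrow> y \<notin> Y"
    using assms(6) wfE_min by (metis ex_in_conv)
  moreover obtain y where "(x, y) \<in> P" "(y, x) \<in> G"
    using assms(4) \<open>x \<in> Y\<close> by blast
  ultimately show False using assms(5) by blast
qed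

text \<open>\<open>Z\<close> absorbs \<open>P\<close> and \<open>G\<close>, which together cover
  \<open>Y \<times> Y\<close>, so one pair in \<open>Z\<close> forces all pairs into it. Then
  \<open>P O G\<close> is empty; but unfolding \<open>Z = P O Z\<close> and then
  \<open>Z = G O Z\<close> yields a step in \<open>P\<close> followed by one in
  \<open>G\<close>.\<close>

lemma zero_relation_empty:
  assumes "P \<subseteq> Y \<times> Y" and "G = Y \<times> Y - P" and "Z \<subseteq> Y \<times> Y"
    and "Z O P = Z" "Z O G = Z" "P O Z = Z" "G O Z = Z"
    and "P O G = Y \<times> Y - Z"
  shows "Z = {}"
proof (rule ccontr)
  assume "Z \<noteq> {}"
  then obtain x y where xy: "(x, y) \<in> Z" by auto
  have cover: "Y \<times> Y = P \<union> G" using assms(1,2) by blast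
  have "(u, v) \<in> Z" if "u \<in> Y" "v \<in> Y" for u v
  proof -
    have "(y, v) \<in> P \<union> G" "(u, x) \<in> P \<union> G"
      using cover that xy assms(3) by blast+
    then show ?thesis
      using xy assms(4-7) by blast
  qed
  then have "P O G = {}" using assms(8) by blast
  obtain c where "(x, c) \<in> P" "(c, y) \<in> Z" using xy assms(6) by blast
  moreover from this obtain d where "(c, d) \<in> G" using assms(7) by blast
  ultimately show False using \<open>P O G = {}\<close> by blast
qed

subsection \<open>The point algebra\<close>

text \<open>
  The point algebra on a copy \<open>range f\<close> of the rationals, obtained as the set of relations invariant
  under the increasing affine maps: it is closed under all operations since these maps are
  permutations, and finite since they act on pairs with only three orbits.
\<close>

definition point_algebra :: "(rat \<Rightarrow> 'b) \<Rightarrow> 'b rel set" where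
  "point_algebra f = {R. R \<subseteq> range f \<times> range f \<and>
     (\<forall>a b x y. 0 < a \<longrightarrow> ((f (a * x + b), f (a * y + b)) \<in> R \<longleftrightarrow> (f x, f y) \<in> R))}"

lemma point_algebraI:
  assumes "R \<subseteq> range f \<times> range f"
    and "\<And>a b x y. 0 < a \<Longrightarrow> (f (a * x + b), f (a * y + b)) \<in> R \<longleftrightarrow> (f x, f y) \<in> R"
  shows "R \<in> point_algebra f"
  using assms by (auto simp: point_algebra_def)

lemma point_algebra_subset: "R \<in> point_algebra f \<Longrightarrow> R \<subseteq> range f \<times> range f"
  by (simp add: point_algebra_def)

lemma range_rel_eqI:
  assumes "R \<subseteq> range f \<times> range f" and "S \<subseteq> range f \<times> range f"
    and "\<And>x y. (f x, f y) \<in> R \<longleftrightarrow> (f x, f y) \<in> S"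
  shows "R = S"
  using assms by blast

lemma point_algebra_affine:
  "R \<in> point_algebra f \<Longrightarrow> 0 < a \<Longrightarrow> (f (a * x + b), f (a * y + b)) \<in> R \<longleftrightarrow> (f x, f y) \<in> R"
  by (auto simp: point_algebra_def)

lemma point_algebra_Comp:
  assumes "R \<in> point_algebra f" and "S \<in> point_algebra f"
  shows "R O S \<in> point_algebra f"
proof (rule point_algebraI)
  note sub = assms[THEN point_algebra_subset]
  show "R O S \<subseteq> range f \<times> range f"
    using sub by blast
  fix a b x y :: rat assume a: "0 < a"
  have Comp_iff: "(f u, f v) \<in> R O S \<longleftrightarrow> (\<exists>w. (f u, f w) \<in> R \<and> (f w, f v) \<in> S)" for u v
    using sub by blast
  \<comment> \<open>Affine maps with nonzero slope are onto the rationals, so the intermediate point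
    of a composition may be moved along with its ends.\<close>
  have "(\<exists>w. Q w) \<longleftrightarrow> (\<exists>w. Q (a * w + b))" for Q
  proof
    assume "\<exists>w. Q w"
    then obtain w where "Q w" ..
    moreover have "w = a * ((w - b) / a) + b" using a by simp
    ultimately show "\<exists>w. Q (a * w + b)" by metis
  qed blast
  then have "(f (a * x + b), f (a * y + b)) \<in> R O S \<longleftrightarrow>
      (\<exists>w. (f (a * x + b), f (a * w + b)) \<in> R \<and> (f (a * w + b), f (a * y + b)) \<in> S)"
    unfolding Comp_iff .
  also have "\<dots> \<longleftrightarrow> (f x, f y) \<in> R O S"
    using a assms by (simp add: Comp_iff point_algebra_affine)
  finally show "(f (a * x + b), f (a * y + b)) \<in> R O S \<longleftrightarrow> (f x, f y) \<in> R O S" .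
qed

lemma proper_structure_point_algebra:
  assumes "inj f"
  shows "proper_structure \<tau> (range f) (point_algebra f)"
proof -
  have "rel_interp (range f) s xs \<in> point_algebra f"
    if xs: "set xs \<subseteq> point_algebra f" "length xs = arity s" for s xs
  proof (cases s)
    case Comp
    then show ?thesis
      using xs by (auto simp: numeral_2_eq_2 length_Suc_conv point_algebra_Comp)
  next
    \<comment> \<open>Injectivity of \<open>f\<close> and of the affine map make the diagonal
      invariant.\<close>
    case Ident
    then show ?thesis
      using xs assms by (auto simp: Id_on_def inj_eq intro!: point_algebraI)
  qed (use xs in \<open>auto simp: numeral_2_eq_2 length_Suc_conv point_algebra_def\<close>)
  moreover have "point_algebra f \<subseteq> Pow (range f \<times> range f)"
    by (auto simp: point_algebra_def)
  ultimately show ?thesis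
    by (simp add: proper_structure_def is_structure_def rel_structure_def)
qed

lemma finite_point_algebra: "finite (point_algebra f)"
proof -
  let ?type = "\<lambda>R. ((f 0, f 0) \<in> R, (f 0, f 1) \<in> R, (f 1, f 0) \<in> R)"
  have mem: "(f x, f y) \<in> R \<longleftrightarrow>
      (if x = y then (f 0, f 0) \<in> R else if x < y then (f 0, f 1) \<in> R else (f 1, f 0) \<in> R)"
    if "R \<in> point_algebra f" for R x y
    \<comment> \<open>These maps carry (0, 0), (0, 1) and (1, 0), the representatives of the three
      orbits, to (x, x), to (x, y) with x < y, and to (x, y) with y < x.\<close>
    using point_algebra_affine[OF that, of 1 0 x 0]
      point_algebra_affine[OF that, of "y - x" 0 x 1]
      point_algebra_affine[OF that, of "x - y" 1 y 0]
    by auto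
  have "inj_on ?type (point_algebra f)"
  proof (rule inj_onI)
    fix R S assume R: "R \<in> point_algebra f" and S: "S \<in> point_algebra f" and "?type R = ?type S"
    then have "(f x, f y) \<in> R \<longleftrightarrow> (f x, f y) \<in> S" for x y
      unfolding mem[OF R, of x y] mem[OF S, of x y] by simp
    then show "R = S"
      by (rule range_rel_eqI[OF R[THEN point_algebra_subset] S[THEN point_algebra_subset]])
  qed
  then show ?thesis
    by (rule inj_on_finite[OF _ subset_UNIV]) simp
qed

lemma point_algebra_no_finite_base:
  assumes "inj f" and "{Compl, Comp} \<subseteq> \<tau>" and "proper_structure \<tau> Y B"
    and "isomorphism \<tau> (rel_structure (range f) (point_algebra f)) (rel_structure Y B) \<phi>"
  shows "infinite Y"
proof -
  note hom = proper_structure_homomorphism[OF assms(2-4)]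
  define le where "le = {(f x, f y) |x y. x \<le> y}"
  define gt where "gt = {(f x, f y) |x y. y < x}"
  have le_iff: "(f x, f y) \<in> le \<longleftrightarrow> x \<le> y" and gt_iff: "(f x, f y) \<in> gt \<longleftrightarrow> y < x" for x y
    using \<open>inj f\<close> by (auto simp: le_def gt_def inj_eq)
  have le: "le \<in> point_algebra f"
    by (rule point_algebraI) (auto simp: le_iff, auto simp: le_def)
  have gt: "gt \<in> point_algebra f"
    by (rule point_algebraI) (auto simp: gt_iff, auto simp: gt_def)
  have zero: "{} \<in> point_algebra f"
    by (auto intro: point_algebraI)
  have Comp_eqI: "R O S = T"
    if "R \<in> point_algebra f" "S \<in> point_algebra f" "T \<subseteq> range f \<times> range f"
      and "\<And>x z. (\<exists>y. (f x, f y) \<in> R \<and> (f y, f z) \<in> S) \<longleftrightarrow> (f x, f z) \<in> T" for R S T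
  proof -
    have "(f x, f z) \<in> R O S \<longleftrightarrow> (f x, f z) \<in> T" for x z
      using that(4)[of x z] that(1,2)[THEN point_algebra_subset] by blast
    moreover have "R O S \<subseteq> range f \<times> range f"
      using that(1,2)[THEN point_algebra_subset] by blast
    ultimately show ?thesis
      using that(3) by (intro range_rel_eqI)
  qed
  have compl: "range f \<times> range f - le = gt"
    by (rule range_rel_eqI[OF _ point_algebra_subset[OF gt]]) (auto simp: le_iff gt_iff)
  have "le O le = le"
    by (rule Comp_eqI[OF le le point_algebra_subset[OF le]]) (auto simp: le_iff)
  \<comment> \<open>Density of the rationals gives the inclusion from right to left.\<close>
  moreover have "gt O gt = gt"
    by (rule Comp_eqI[OF gt gt point_algebra_subset[OF gt]]) (auto simp: gt_iff dest: dense)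
  \<comment> \<open>The full relation is written as the complement of \<open>{}\<close>, so that
    preservation of complements turns its image into \<open>Y \<times> Y - \<phi> {}\<close>. It is
    reached through a point above both ends.\<close>
  moreover have "le O gt = range f \<times> range f - {}"
  proof (rule Comp_eqI[OF le gt])
    fix x z :: rat
    have "x \<le> max x z + 1" "z < max x z + 1" by linarith+
    then show "(\<exists>y. (f x, f y) \<in> le \<and> (f y, f z) \<in> gt) \<longleftrightarrow> (f x, f z) \<in> range f \<times> range f - {}"
      by (auto simp: le_iff gt_iff)
  qed simp
  ultimately have PP: "\<phi> le O \<phi> le = \<phi> le" and GG: "\<phi> gt O \<phi> gt = \<phi> gt"
    and PG: "\<phi> le O \<phi> gt = Y \<times> Y - \<phi> {}"
    using hom(4)[OF le le] hom(4)[OF gt gt] hom(4)[OF le gt] hom(3)[OF zero] by simp_all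
  have G: "\<phi> gt = Y \<times> Y - \<phi> le"
    using hom(3)[OF le] by (simp add: compl)
  have "\<phi> {} = {}"
    using hom(4)[OF zero le] hom(4)[OF zero gt] hom(4)[OF le zero] hom(4)[OF gt zero]
    by (intro zero_relation_empty[OF hom(2)[OF le] G hom(2)[OF zero] _ _ _ _ PG]) simp_all
  show ?thesis
  proof (rule infinite_if_complementary_transitive[of "\<phi> le" "\<phi> gt"])
    show "trans (\<phi> le)" "trans (\<phi> gt)"
      using PP GG by (blast intro: transI)+
    show "\<phi> le \<inter> \<phi> gt = {}"
      using G by blast
    show "Id_on Y \<subseteq> \<phi> le O \<phi> gt"
      using PG \<open>\<phi> {} = {}\<close> by auto
    show "\<phi> le \<subseteq> Y \<times> Y"
      by (rule hom(2)[OF le])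
    \<comment> \<open>Over an empty base both images would be empty, against injectivity of
      \<phi>.\<close>
    have "le \<noteq> gt"
      using le_iff[of 0 0] gt_iff[of 0 0] by auto
    then have "\<phi> le \<noteq> \<phi> gt"
      using hom(1) le gt by (auto dest: inj_onD)
    then show "Y \<noteq> {}"
      using hom(2)[OF le] hom(2)[OF gt] by auto
  qed
qed

theorem theorem1:
  fixes \<tau> :: "ra_symbol set"
  assumes "{Compl, Comp} \<subseteq> \<tau>"
  shows "\<not> has_FRP TYPE('a::infinite) TYPE('b::infinite) \<tau>"
proof
  assume FRP: "has_FRP TYPE('a) TYPE('b) \<tau>"
  \<comment> \<open>An infinite type contains a copy of the naturals, hence of the countable set of
    rationals, to serve as the base.\<close>
  obtain g :: "nat \<Rightarrow> 'b" where "inj g"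
    using infinite_countable_subset[OF infinite_UNIV] by blast
  then have f: "inj (g \<circ> (to_nat :: rat \<Rightarrow> nat))" (is "inj ?f")
    by (intro inj_compose inj_to_nat)
  note A = proper_structure_point_algebra[OF f, of \<tau>]
  obtain M :: "'a ra_structure" and k
    where k: "bij_betw k (point_algebra ?f) (universe M)"
      "isomorphism \<tau> (rel_structure (range ?f) (point_algebra ?f)) M k"
    using finite_proper_structure_copy[OF A finite_point_algebra] by blast
  have "finite (universe M)"
    using k(1) finite_point_algebra bij_betw_finite by blast
  moreover have "representable TYPE('b) \<tau> M"
    using A isomorphism_inv_into[OF k(2)] by (auto simp: representable_def representation_def)
  ultimately obtain Y :: "'b set" and h where "finite Y" "representation \<tau> M Y h"
    using FRP by (auto simp: has_FRP_def finitely_representable_def)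
  then obtain B where "proper_structure \<tau> Y B" "isomorphism \<tau> M (rel_structure Y B) h"
    by (auto simp: representation_def)
  then have "infinite Y"
    using point_algebra_no_finite_base[OF f assms] isomorphism_comp[OF k(2)] by blast
  with \<open>finite Y\<close> show False by simp
qed

end
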